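(* For $t\in\mathbf{Q}$ (whenever the denominators below are nonzero) put $$a(t)=-\frac{(t-1)(t+1)(t^2+1)(t^4+1)(t^2-t-1)(t^2+t-1)(t^4-t^2+1)(t^6+4t^4-6t^3+4t^2+1)(t^6+4t^4+6t^3+4t^2+1)}{t^2\,(t^6+t^4-2t^2+3t+1)^2\,(t^6-3t^5-2t^4+t^2+1)^2},$$ $$b(t)=-\frac{t^2\,(t^6+t^4-2t^2+3t+1)^2}{(t^6-3t^5-2t^4+t^2+1)^2},$$ $$c(t)=-\frac{24t^3(t^2+1)(t^4+3t^2+1)(t^6-2t^4+t^2+1)(t^6+t^4-2t^2+1)}{(t^6+t^4-2t^2+3t+1)^2\,(t^6-3t^5-2t^4+t^2+1)^2},$$ $$d(t)=\frac{(t^6-3t^5-2t^4+t^2+1)^2}{t^2\,(t^6+t^4-2t^2+3t+1)^2}.$$ Then there is a finite set $S\subset\mathbf{Q}$ such that for every $t\in\mathbf{Q}\setminus S$ the numbers $a(t),b(t),c(t),d(t)$ are well defined and $\{a(t),b(t),c(t),d(t)\}$ is a quartic rational Diophantine quadruple.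
   Context: A quartic rational Diophantine quadruple is a set of four pairwise distinct nonzero rational numbers $\{a_1,a_2,a_3,a_4\}$ such that for every $1\le i<j\le 4$ the number $a_ia_j+1$ is a fourth power in $\mathbf{Q}$ (where $0=0^4$ counts as a fourth power). *)

theory Defs
  imports Complex_Main "HOL-Computational_Algebra.Nth_Powers"
begin

definition quartic_rational_diophantine_quadruple :: "rat set \<Rightarrow> bool" where
  "quartic_rational_diophantine_quadruple A \<longleftrightarrow>
     card A = 4 \<and> 0 \<notin> A \<and> pairwise (\<lambda>x y. is_nth_power 4 (x * y + 1)) A"

(* Since x / 0 = 0 in HOL, the denominators are kept as separate constants, so that
   "a(t), ..., d(t) are well defined" can be stated as an explicit condition. *)

definition pol_p :: "rat \<Rightarrow> rat" where
  "pol_p t = t^6 + t^4 - 2*t^2 + 3*t + 1"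

definition pol_q :: "rat \<Rightarrow> rat" where
  "pol_q t = t^6 - 3*t^5 - 2*t^4 + t^2 + 1"

definition den_a :: "rat \<Rightarrow> rat" where
  "den_a t = t^2 * (pol_p t)^2 * (pol_q t)^2"

definition den_b :: "rat \<Rightarrow> rat" where
  "den_b t = (pol_q t)^2"

definition den_c :: "rat \<Rightarrow> rat" where
  "den_c t = (pol_p t)^2 * (pol_q t)^2"

definition den_d :: "rat \<Rightarrow> rat" where
  "den_d t = t^2 * (pol_p t)^2"

definition fun_a :: "rat \<Rightarrow> rat" where
  "fun_a t = - (((t - 1) * (t + 1) * (t^2 + 1) * (t^4 + 1) * (t^2 - t - 1) * (t^2 + t - 1) *
       (t^4 - t^2 + 1) * (t^6 + 4*t^4 - 6*t^3 + 4*t^2 + 1) * (t^6 + 4*t^4 + 6*t^3 + 4*t^2 + 1))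
     / den_a t)"

definition fun_b :: "rat \<Rightarrow> rat" where
  "fun_b t = - ((t^2 * (pol_p t)^2) / den_b t)"

definition fun_c :: "rat \<Rightarrow> rat" where
  "fun_c t = - ((24 * t^3 * (t^2 + 1) * (t^4 + 3*t^2 + 1) * (t^6 - 2*t^4 + t^2 + 1) *
       (t^6 + t^4 - 2*t^2 + 1)) / den_c t)"

definition fun_d :: "rat \<Rightarrow> rat" where
  "fun_d t = (pol_q t)^2 / den_d t"

definition abcd_well_defined :: "rat \<Rightarrow> bool" where
  "abcd_well_defined t \<longleftrightarrow> den_a t \<noteq> 0 \<and> den_b t \<noteq> 0 \<and> den_c t \<noteq> 0 \<and> den_d t \<noteq> 0"

end

(* Writing fun_a = - num_a / (t p q)^2 and fun_c = - num_c / (p q)^2, each product plus 1 is an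
   explicit fourth power, by polynomial identities in t whose fourth roots are built from p(t),
   q(t), p(-t), q(-t) and one further polynomial of degree 12. Since fun_b * fun_d = -1, an element
   x coincides with fun_b or fun_d exactly when x * fun_d + 1 or x * fun_b + 1 vanishes, so
   distinctness follows from the nonvanishing of the same fourth roots; only fun_a and fun_c need
   to be compared directly. All exceptional t are roots of finitely many nonzero polynomials. *)

theory Submission
  imports Defs "HOL-Computational_Algebra.Polynomial"
begin

(* Polymorphic, so that they can be evaluated both at rational t and at the polynomial X. *)

definition num_a :: "'a::comm_ring_1 \<Rightarrow> 'a" where
  "num_a t = (t - 1) * (t + 1) * (t^2 + 1) * (t^4 + 1) * (t^2 - t - 1) * (t^2 + t - 1) *
     (t^4 - t^2 + 1) * (t^6 + 4*t^4 - 6*t^3 + 4*t^2 + 1) * (t^6 + 4*t^4 + 6*t^3 + 4*t^2 + 1)"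

definition num_c :: "'a::comm_ring_1 \<Rightarrow> 'a" where
  "num_c t = 24 * t^3 * (t^2 + 1) * (t^4 + 3*t^2 + 1) * (t^6 - 2*t^4 + t^2 + 1) *
     (t^6 + t^4 - 2*t^2 + 1)"

text \<open>The fourth root of \<open>fun_a t * fun_c t + 1\<close>, cleared of its denominator
  \<open>pol_p t * pol_q t\<close>.\<close>

definition root_ac :: "rat \<Rightarrow> rat" where
  "root_ac t = t^12 + 3*t^11 - t^10 + 3*t^9 - 3*t^8 - 9*t^7 - 2*t^6 + 9*t^5 - 3*t^4 - 3*t^3
     - t^2 - 3*t + 1"

lemma poly_num_a: "poly (num_a P) t = num_a (poly P t)"
  by (simp add: num_a_def)

lemma poly_num_c: "poly (num_c P) t = num_c (poly P t)"
  by (simp add: num_c_def)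

lemma num_a_plus_pol_q_power4: "num_a t + pol_q t ^ 4 = (t * pol_p (- t)) ^ 4"
  unfolding num_a_def pol_p_def pol_q_def by algebra

text \<open>Since \<open>num_a\<close> is even, this is the previous identity at -t. Adding the two
  gives (t p(t))^4 + q(t)^4 = (t p(-t))^4 + q(-t)^4, Euler's degree 7 parametrization of A^4 + B^4 =
  C^4 + D^4.\<close>

lemma pol_p_power4_minus_num_a: "(t * pol_p t) ^ 4 - num_a t = pol_q (- t) ^ 4"
  unfolding num_a_def pol_p_def pol_q_def by algebra

lemma num_c_plus_pol_q_power4: "t^2 * num_c t + pol_q t ^ 4 = pol_q (- t) ^ 4"
  unfolding num_c_def pol_q_def by algebra

text \<open>Euler's identity rewrites q(-t)^4 - q(t)^4 as t^4 (p(t)^4 - p(-t)^4), so this is the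
  previous lemma divided by t^2.\<close>

lemma pol_p_power4_minus_num_c: "t^2 * pol_p t ^ 4 - num_c t = t^2 * pol_p (- t) ^ 4"
  unfolding num_c_def pol_p_def by algebra

lemma num_a_num_c_plus_power4:
  "num_a t * num_c t + t^2 * (pol_p t * pol_q t) ^ 4 = t^2 * root_ac t ^ 4"
  unfolding num_a_def num_c_def pol_p_def pol_q_def root_ac_def by algebra

lemma fun_a_eq: "fun_a t = - num_a t / (t * pol_p t * pol_q t) ^ 2"
  by (simp add: fun_a_def den_a_def num_a_def power_mult_distrib)

lemma fun_b_eq: "fun_b t = - ((t * pol_p t / pol_q t) ^ 2)"
  by (simp add: fun_b_def den_b_def power_mult_distrib power_divide)

lemma fun_c_eq: "fun_c t = - num_c t / (pol_p t * pol_q t) ^ 2"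
  by (simp add: fun_c_def den_c_def num_c_def power_mult_distrib)

lemma fun_d_eq: "fun_d t = (pol_q t / (t * pol_p t)) ^ 2"
  by (simp add: fun_d_def den_d_def power_mult_distrib power_divide)

context
  fixes t :: rat
  assumes nz: "t \<noteq> 0" "pol_p t \<noteq> 0" "pol_q t \<noteq> 0"
begin

text \<open>The squares in the two factors combine, leaving \<open>pol_q t ^ 4\<close> as
  denominator. The other products work alike, at times with an extra t^2 that cancels against the
  numerator.\<close>

lemma fun_a_fun_b: "fun_a t * fun_b t + 1 = (t * pol_p (- t) / pol_q t) ^ 4"
proof -
  have "fun_a t * fun_b t + 1 = (num_a t + pol_q t ^ 4) / pol_q t ^ 4"
    using nz by (simp add: fun_a_eq fun_b_eq field_simps power4_eq_xxxx power2_eq_square)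
  then show ?thesis by (simp add: num_a_plus_pol_q_power4 power_divide)
qed

lemma fun_a_fun_d: "fun_a t * fun_d t + 1 = (pol_q (- t) / (t * pol_p t)) ^ 4"
proof -
  have "fun_a t * fun_d t + 1 = ((t * pol_p t) ^ 4 - num_a t) / (t * pol_p t) ^ 4"
    using nz by (simp add: fun_a_eq fun_d_eq field_simps power4_eq_xxxx power2_eq_square)
  then show ?thesis by (simp add: pol_p_power4_minus_num_a power_divide)
qed

lemma fun_b_fun_c: "fun_b t * fun_c t + 1 = (pol_q (- t) / pol_q t) ^ 4"
proof -
  have "fun_b t * fun_c t + 1 = (t^2 * num_c t + pol_q t ^ 4) / pol_q t ^ 4"
    using nz by (simp add: fun_b_eq fun_c_eq field_simps power4_eq_xxxx power2_eq_square)
  then show ?thesis by (simp add: num_c_plus_pol_q_power4 power_divide)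
qed

lemma fun_c_fun_d: "fun_c t * fun_d t + 1 = (pol_p (- t) / pol_p t) ^ 4"
proof -
  have "fun_c t * fun_d t + 1 = (t^2 * pol_p t ^ 4 - num_c t) / (t^2 * pol_p t ^ 4)"
    using nz by (simp add: fun_c_eq fun_d_eq field_simps power4_eq_xxxx power2_eq_square)
  then show ?thesis using nz by (simp add: pol_p_power4_minus_num_c power_divide)
qed

lemma fun_a_fun_c: "fun_a t * fun_c t + 1 = (root_ac t / (pol_p t * pol_q t)) ^ 4"
proof -
  have "fun_a t * fun_c t + 1 =
      (num_a t * num_c t + t^2 * (pol_p t * pol_q t) ^ 4) / (t^2 * (pol_p t * pol_q t) ^ 4)"
    using nz by (simp add: fun_a_eq fun_c_eq field_simps power4_eq_xxxx power2_eq_square)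
  then show ?thesis using nz by (simp add: num_a_num_c_plus_power4 power_divide)
qed

text \<open>The two are negative reciprocals, so this pair yields the degenerate fourth power 0 =
  0^4.\<close>

lemma fun_b_fun_d: "fun_b t * fun_d t = - 1"
  using nz by (simp add: fun_b_eq fun_d_eq power_divide)

lemma fun_a_eq_fun_c_iff: "fun_a t = fun_c t \<longleftrightarrow> num_a t - t^2 * num_c t = 0"
proof -
  have "fun_c t = - (t^2 * num_c t) / (t * pol_p t * pol_q t) ^ 2"
    using nz by (simp add: fun_c_eq power_mult_distrib)
  then show ?thesis
    using nz by (simp add: fun_a_eq)
qed

lemma abcd_quadruple:
  assumes "num_a t \<noteq> 0" "num_c t \<noteq> 0" "pol_p (- t) \<noteq> 0" "pol_q (- t) \<noteq> 0"
    and "num_a t - t^2 * num_c t \<noteq> 0"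
  shows "quartic_rational_diophantine_quadruple {fun_a t, fun_b t, fun_c t, fun_d t}"
proof -
  have nonzero: "fun_a t \<noteq> 0" "fun_b t \<noteq> 0" "fun_c t \<noteq> 0" "fun_d t \<noteq> 0"
    using nz assms by (simp_all add: fun_a_eq fun_b_eq fun_c_eq fun_d_eq)
  have "fun_a t \<noteq> fun_b t"
    using fun_a_fun_d fun_b_fun_d nz assms by auto
  moreover have "fun_a t \<noteq> fun_d t"
    using fun_a_fun_b fun_b_fun_d nz assms by (auto simp: mult.commute)
  moreover have "fun_c t \<noteq> fun_b t"
    using fun_c_fun_d fun_b_fun_d nz assms by auto
  moreover have "fun_c t \<noteq> fun_d t"
    using fun_b_fun_c fun_b_fun_d nz assms by auto
  moreover have "fun_b t \<noteq> fun_d t"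
  proof
    assume "fun_b t = fun_d t"
    then have "fun_d t * fun_d t = - 1" using fun_b_fun_d by simp
    then show False using zero_le_square[of "fun_d t"] by simp
  qed
  moreover have "fun_a t \<noteq> fun_c t"
    using assms fun_a_eq_fun_c_iff by simp
  ultimately have "card {fun_a t, fun_b t, fun_c t, fun_d t} = 4"
    by auto
  moreover have "is_nth_power 4 (fun_a t * fun_b t + 1)" "is_nth_power 4 (fun_a t * fun_c t + 1)"
    "is_nth_power 4 (fun_a t * fun_d t + 1)" "is_nth_power 4 (fun_b t * fun_c t + 1)"
    "is_nth_power 4 (fun_b t * fun_d t + 1)" "is_nth_power 4 (fun_c t * fun_d t + 1)"
    by (simp_all add: fun_a_fun_b fun_a_fun_c fun_a_fun_d fun_b_fun_c fun_b_fun_d fun_c_fun_d)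
  ultimately show ?thesis
    using nonzero
    by (auto simp: quartic_rational_diophantine_quadruple_def pairwise_insert mult.commute)
qed

end

text \<open>One nonzero value certifies that \<open>P\<close> is not the zero polynomial, so its
  coefficients need not be computed.\<close>

lemma finite_zeros_of_poly:
  fixes f :: "rat \<Rightarrow> rat"
  assumes "\<And>t. poly P t = f t" and "f x \<noteq> 0"
  shows "finite {t. f t = 0}"
proof -
  have "P \<noteq> 0" using assms(1)[of x] assms(2) by auto
  then show ?thesis using poly_roots_finite[of P] assms(1) by simp
qed

theorem mainTheorem3:
  shows "\<exists>S :: rat set. finite S \<and>
    (\<forall>t. t \<notin> S \<longrightarrow>
       abcd_well_defined t \<and>
       quartic_rational_diophantine_quadruple {fun_a t, fun_b t, fun_c t, fun_d t})"
proof -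
  let ?X = "[:0, 1:] :: rat poly"
  have poly_X: "poly ?X t = t" for t
    by simp
  \<comment> \<open>The first three sets secure the denominators, the zeros at -t concern the fourth
    roots, those of \<open>num_a\<close> and \<open>num_c\<close> keep 0 out of the quadruple, and
    the last set separates \<open>fun_a t\<close> from \<open>fun_c t\<close>.\<close>
  let ?S = "{0} \<union> {t. pol_p t = 0} \<union> {t. pol_q t = 0} \<union> {t. pol_p (- t) = 0}
    \<union> {t. pol_q (- t) = 0} \<union> {t. num_a t = 0} \<union> {t. num_c t = 0}
    \<union> {t. num_a t - t^2 * num_c t = 0}"
  have "poly [:1, 3, -2, 0, 1, 0, 1:] t = pol_p t" for t
    unfolding pol_p_def poly_pCons poly_0 by algebra
  then have "finite {t. pol_p t = 0}"
    by (rule finite_zeros_of_poly[where x = 0]) (simp add: pol_p_def)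
  moreover have "poly [:1, 0, 1, 0, -2, -3, 1:] t = pol_q t" for t
    unfolding pol_q_def poly_pCons poly_0 by algebra
  then have "finite {t. pol_q t = 0}"
    by (rule finite_zeros_of_poly[where x = 0]) (simp add: pol_q_def)
  moreover have "finite {t. num_a t = (0::rat)}"
    by (rule finite_zeros_of_poly[of "num_a ?X" _ 0])
      (simp only: poly_num_a poly_X, simp add: num_a_def)
  \<comment> \<open>The sample point is 1 here because the factor t^3 makes \<open>num_c\<close>
    vanish at 0; \<open>num_c\<close> takes the value 240 at 1.\<close>
  moreover have "finite {t. num_c t = (0::rat)}"
    by (rule finite_zeros_of_poly[of "num_c ?X" _ 1])
      (simp only: poly_num_c poly_X, simp add: num_c_def)
  moreover have "finite {t. num_a t - t^2 * num_c t = (0::rat)}"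
    by (rule finite_zeros_of_poly[of "num_a ?X - ?X^2 * num_c ?X" _ 0])
      (simp only: poly_num_a poly_num_c poly_X poly_diff poly_mult poly_power,
       simp add: num_a_def num_c_def)
  \<comment> \<open>These are preimages of the first two zero sets under the injective map t to
    -t.\<close>
  moreover have "finite {t. pol_p (- t) = 0}" "finite {t. pol_q (- t) = 0}"
    using calculation(1,2)[THEN finite_vimageI, of uminus] by (simp_all add: vimage_def)
  ultimately have finite_S: "finite ?S"
    by simp
  have good: "abcd_well_defined t \<and>
      quartic_rational_diophantine_quadruple {fun_a t, fun_b t, fun_c t, fun_d t}"
    if "t \<notin> ?S" for t
    using that abcd_quadruple[of t]
    by (simp add: abcd_well_defined_def den_a_def den_b_def den_c_def den_d_def)
  show ?thesis
    by (intro exI[of _ ?S] conjI[OF finite_S] allI impI good)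
qed

end
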